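(* For all integers $n \ge 0$ and $k \ge 0$, $$\left\langle {n \atop k} \right\rangle_q = \sum_{\lambda \in P_{n+1,k+1}} w(\lambda),$$ where $P_{m,r}$ denotes the set of all integer partitions of $m$ with largest (first) part equal to $r$, and where the weight of a partition $\lambda = (\lambda_1, \lambda_2, \ldots, \lambda_\ell)$, $\lambda_1 \ge \lambda_2 \ge \cdots \ge \lambda_\ell \ge 1$, is $$w(\lambda) = \left(\prod_{i=1}^{\ell-1} \binom{\lambda_i}{\lambda_{i+1}}\right) q^{\sum_{i=1}^{\ell} (i-1)\lambda_i}.$$
   Context: Let $q$ be an indeterminate and let $f(x) = \sum_{n \geq 0} q^{\binom{n+1}{2}} x^n$, a formal power series in $x$ with coefficients in $\mathbb{Z}[q]$. The $q$-binomial coefficients $\left\langle {n \atop k} \right\rangle_q \in \mathbb{Z}[q]$ (these are not the Gaussian binomial coefficients) are defined for integers $n, k \ge 0$ by $$f(x)^{k+1} = \sum_{n \geq 0} \left\langle {n+k \atop k} \right\rangle_q x^n ,$$ that is, $\left\langle {n \atop k} \right\rangle_q$ is the coefficient of $x^{n-k}$ in $f(x)^{k+1}$ for $0 \le k \le n$, and $\left\langle {n \atop k} \right\rangle_q = 0$ for $k > n$. An integer partition of $m$ is a finite weakly decreasing sequence of positive integers with sum $m$. Empty products equal $1$ and empty sums equal $0$. *)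

theory Defs
  imports "HOL-Computational_Algebra.Computational_Algebra"
begin

definition qvar :: "int poly" where
  "qvar = [:0, 1:]"

definition gen_f :: "int poly fps" where
  "gen_f = Abs_fps (\<lambda>n. qvar ^ ((n + 1) choose 2))"

text \<open>These are not the Gaussian binomial coefficients.\<close>

definition qbinomial :: "nat \<Rightarrow> nat \<Rightarrow> int poly" where
  "qbinomial n k = (if k \<le> n then fps_nth (gen_f ^ (k + 1)) (n - k) else 0)"

lemma gen_f_power_eq_qbinomial: "gen_f ^ (k + 1) = Abs_fps (\<lambda>n. qbinomial (n + k) k)"
  by (rule fps_ext) (simp add: qbinomial_def)

definition is_partition :: "nat \<Rightarrow> nat list \<Rightarrow> bool" where
  "is_partition m xs \<longleftrightarrow> sorted_wrt (\<ge>) xs \<and> (\<forall>x\<in>set xs. x > 0) \<and> sum_list xs = m"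

definition partitions_largest :: "nat \<Rightarrow> nat \<Rightarrow> nat list set" where
  "partitions_largest m r = {xs. is_partition m xs \<and> xs \<noteq> [] \<and> hd xs = r}"

text \<open>Lists are indexed from 0, so the part \<open>\<lambda>\<^sub>i\<close> is \<open>xs ! (i - 1)\<close>.\<close>

definition weight :: "nat list \<Rightarrow> int poly" where
  "weight xs =
     of_nat (\<Prod>i = 1..length xs - 1. (xs ! (i - 1)) choose (xs ! i)) *
     qvar ^ (\<Sum>i = 1..length xs. (i - 1) * xs ! (i - 1))"

text \<open>Finiteness matters because \<open>sum\<close> over an infinite set is 0 by convention.\<close>

lemma finite_partitions_largest: "finite (partitions_largest m r)"
proof (rule finite_subset)
  have len: "length xs \<le> sum_list xs" if "\<forall>x\<in>set xs. x > 0" for xs :: "nat list"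
    using that by (induction xs) auto
  show "partitions_largest m r \<subseteq> {xs. set xs \<subseteq> {0..m} \<and> length xs \<le> m}"
    using len
    by (auto simp: partitions_largest_def is_partition_def intro: member_le_sum_list)
  show "finite {xs. set xs \<subseteq> {0..m} \<and> length xs \<le> m}"
    by (rule finite_lists_length_le) simp
qed

end

theory Submission imports Defs
begin

text \<open>
  The series \<open>f\<close> satisfies \<open>f(x) = 1 + q x f(q x)\<close>. Raising this to the power \<open>r\<close> and
  expanding by the binomial theorem shows that the coefficient of \<open>x\<^sup>m\<close> in \<open>f\<^sup>r\<close> is \<open>q\<^sup>m\<close> times
  the sum over \<open>j\<close> of \<open>r choose j\<close> times the coefficient of \<open>x\<^bsup>m-j\<^esup>\<close> in \<open>f\<^sup>j\<close>. Removing the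
  first part \<open>r\<close> of a partition of \<open>r + m\<close>, and splitting by the next part \<open>j\<close>, gives the same
  recursion for the weighted sums.
\<close>

text \<open>Shifting the index by one adds \<open>Suc m\<close> to the triangular exponent: one
  factor q is the explicit prefactor, and the other m come from replacing x by q x.\<close>

lemma gen_f_functional_equation:
  "gen_f = 1 + fps_const qvar * fps_X * (gen_f oo (fps_const qvar * fps_X))"
proof (rule fps_ext)
  fix n
  show "fps_nth gen_f n
      = fps_nth (1 + fps_const qvar * fps_X * (gen_f oo (fps_const qvar * fps_X))) n"
  proof (cases n)
    case 0
    then show ?thesis by (simp add: gen_f_def mult.assoc numeral_2_eq_2)
  next
    case (Suc m)
    have "(Suc m + 1) choose 2 = Suc m + ((m + 1) choose 2)"
      by (simp add: numeral_2_eq_2)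
    then show ?thesis
      unfolding Suc by (simp add: gen_f_def mult.assoc fps_compose_linear power_add)
  qed
qed

lemma gen_f_power_nth_rec:
  "fps_nth (gen_f ^ r) m
     = qvar ^ m * (\<Sum>j\<le>r. of_nat (r choose j) *
         (if j \<le> m then fps_nth (gen_f ^ j) (m - j) else 0))"
proof -
  define g where "g = fps_const qvar * fps_X * (gen_f oo (fps_const qvar * fps_X))"
  \<comment> \<open>The power \<open>qvar ^ m\<close> does not depend on j: the prefactor of
    \<open>g ^ j\<close> supplies j of its factors, and the substitution of q x at index m - j
    supplies the rest.\<close>
  have g_power: "fps_nth (g ^ j) m
      = (if j \<le> m then qvar ^ m * fps_nth (gen_f ^ j) (m - j) else 0)" for j
  proof -
    have "g ^ j = fps_const (qvar ^ j) * (fps_X ^ j * (gen_f ^ j oo (fps_const qvar * fps_X)))"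
      by (simp add: g_def power_mult_distrib fps_compose_power mult.assoc)
    then show ?thesis
      by (simp add: fps_X_power_mult_nth fps_compose_linear mult.assoc flip: power_add)
  qed
  have "gen_f = g + 1"
    unfolding g_def by (subst add.commute) (rule gen_f_functional_equation)
  then have "gen_f ^ r = (g + 1) ^ r"
    by (rule arg_cong)
  also have "\<dots> = (\<Sum>j\<le>r. of_nat (r choose j) * g ^ j)"
    by (simp add: binomial_ring)
  finally have "fps_nth (gen_f ^ r) m = (\<Sum>j\<le>r. of_nat (r choose j) * fps_nth (g ^ j) m)"
    by (simp add: fps_sum_nth)
  then show ?thesis
    by (auto simp: g_power sum_distrib_left intro!: sum.cong)
qed

text \<open>Prepending x moves each part of \<open>xs\<close> one place to the right, which raises
  its multiplier in the exponent by one; the total increase is \<open>sum_list xs\<close>. The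
  product gains only the factor for the new adjacent pair, which exists because \<open>xs\<close> is
  nonempty.\<close>

lemma weight_Cons:
  assumes "xs \<noteq> []"
  shows "weight (x # xs) = of_nat (x choose hd xs) * qvar ^ sum_list xs * weight xs"
proof -
  obtain l where l: "length xs = Suc l"
    using assms by (cases xs) auto
  have "(\<Prod>i = 1..length (x # xs) - 1. (x # xs) ! (i - 1) choose ((x # xs) ! i))
      = (\<Prod>i<Suc l. (x # xs) ! i choose (xs ! i))"
    by (simp add: l prod.atLeast1_atMost_eq)
  also have "\<dots> = (x choose hd xs) * (\<Prod>i<l. xs ! i choose (xs ! Suc i))"
    using assms by (simp only: prod.lessThan_Suc_shift) (simp add: hd_conv_nth)
  also have "(\<Prod>i<l. xs ! i choose (xs ! Suc i))
      = (\<Prod>i = 1..length xs - 1. xs ! (i - 1) choose (xs ! i))"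
    by (simp add: l prod.atLeast1_atMost_eq)
  finally have binomials: "(\<Prod>i = 1..length (x # xs) - 1. (x # xs) ! (i - 1) choose ((x # xs) ! i))
      = (x choose hd xs) * (\<Prod>i = 1..length xs - 1. xs ! (i - 1) choose (xs ! i))" .
  have "(\<Sum>i = 1..length (x # xs). (i - 1) * (x # xs) ! (i - 1))
      = (\<Sum>i<Suc (length xs). i * (x # xs) ! i)"
    by (simp add: sum.atLeast1_atMost_eq)
  also have "\<dots> = (\<Sum>i<length xs. xs ! i + i * xs ! i)"
    by (simp only: sum.lessThan_Suc_shift) simp
  also have "\<dots> = sum_list xs + (\<Sum>i = 1..length xs. (i - 1) * xs ! (i - 1))"
    by (simp add: sum.distrib sum_list_sum_nth atLeast0LessThan sum.atLeast1_atMost_eq)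
  finally have exponents: "(\<Sum>i = 1..length (x # xs). (i - 1) * (x # xs) ! (i - 1))
      = sum_list xs + (\<Sum>i = 1..length xs. (i - 1) * xs ! (i - 1))" .
  show ?thesis
    unfolding weight_def binomials exponents by (simp add: power_add algebra_simps)
qed

lemma partitions_largest_Cons:
  assumes "r > 0" "m > 0"
  shows "partitions_largest (r + m) r = (\<Union>j\<le>r. (#) r ` partitions_largest m j)"
proof (intro equalityI subsetI)
  fix ys assume "ys \<in> partitions_largest (r + m) r"
  then obtain xs where "ys = r # xs" "is_partition (r + m) (r # xs)"
    by (cases ys) (auto simp: partitions_largest_def)
  moreover from this have "xs \<noteq> []"
    using assms by (auto simp: is_partition_def)
  ultimately show "ys \<in> (\<Union>j\<le>r. (#) r ` partitions_largest m j)"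
    by (auto simp: partitions_largest_def is_partition_def)
next
  fix ys assume "ys \<in> (\<Union>j\<le>r. (#) r ` partitions_largest m j)"
  then obtain xs where xs: "ys = r # xs" "xs \<in> partitions_largest m (hd xs)" "hd xs \<le> r"
    by (auto simp: partitions_largest_def)
  \<comment> \<open>The tail is weakly decreasing, so bounding its head by r bounds every part; this
    keeps \<open>r # xs\<close> sorted.\<close>
  then have "\<forall>x\<in>set xs. x \<le> r"
    by (cases xs) (auto simp: partitions_largest_def is_partition_def)
  with xs show "ys \<in> partitions_largest (r + m) r"
    using assms by (auto simp: partitions_largest_def is_partition_def)
qed

lemma partitions_largest_refl:
  assumes "r > 0"
  shows "partitions_largest r r = {[r]}"
proof -
  have "ys = [r]" if "ys \<in> partitions_largest r r" for ys
    using that by (cases ys; cases "tl ys")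
      (auto simp: partitions_largest_def is_partition_def)
  moreover have "[r] \<in> partitions_largest r r"
    using assms by (simp add: partitions_largest_def is_partition_def)
  ultimately show ?thesis by blast
qed

lemma partitions_largest_zero [simp]: "partitions_largest m 0 = {}"
  by (auto simp: partitions_largest_def is_partition_def) (metis hd_in_set less_irrefl)

lemma partitions_largest_empty:
  assumes "m < r"
  shows "partitions_largest m r = {}"
proof -
  have "hd xs \<le> m" if "xs \<noteq> []" "sum_list xs = m" for xs :: "nat list"
    using that by (cases xs) auto
  with assms show ?thesis
    by (auto simp: partitions_largest_def is_partition_def dest: leD)
qed

lemma sum_weight_rec:
  assumes "r > 0" "m > 0"
  shows "(\<Sum>xs\<in>partitions_largest (r + m) r. weight xs)
     = qvar ^ m * (\<Sum>j\<le>r. of_nat (r choose j) * (\<Sum>xs\<in>partitions_largest m j. weight xs))"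
proof -
  have "(\<Sum>xs\<in>partitions_largest (r + m) r. weight xs)
      = (\<Sum>j\<le>r. \<Sum>ys\<in>(#) r ` partitions_largest m j. weight ys)"
    \<comment> \<open>The union is disjoint because j is recovered as the second entry of the
      list.\<close>
    unfolding partitions_largest_Cons[OF assms]
    by (rule sum.UNION_disjoint) (auto simp: finite_partitions_largest, auto simp: partitions_largest_def)
  also have "\<dots> = (\<Sum>j\<le>r. \<Sum>xs\<in>partitions_largest m j. weight (r # xs))"
    by (simp add: sum.reindex)
  also have "\<dots> = (\<Sum>j\<le>r. \<Sum>xs\<in>partitions_largest m j.
      qvar ^ m * (of_nat (r choose j) * weight xs))"
    by (intro sum.cong refl)
      (auto simp: partitions_largest_def is_partition_def weight_Cons algebra_simps)
  finally show ?thesis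
    by (simp add: sum_distrib_left)
qed

text \<open>The recursion passes from the pair (r, m) to (j, m - j), hence strong induction on m
  with r arbitrary. The case r = m = 0 must be excluded: the coefficient is 1 there, but the set of
  partitions is empty.\<close>

lemma gen_f_power_nth:
  assumes "r > 0"
  shows "fps_nth (gen_f ^ r) m = (\<Sum>xs\<in>partitions_largest (r + m) r. weight xs)"
  using assms
proof (induction m arbitrary: r rule: less_induct)
  case (less m)
  show ?case
  proof (cases "m = 0")
    case True
    have "fps_nth gen_f 0 = 1" by (simp add: gen_f_def numeral_2_eq_2)
    with True less.prems show ?thesis
      by (simp add: fps_power_zeroth partitions_largest_refl weight_def)
  next
    case False
    have "(if j \<le> m then fps_nth (gen_f ^ j) (m - j) else 0)
        = (\<Sum>xs\<in>partitions_largest m j. weight xs)" for j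
    \<comment> \<open>The induction hypothesis needs j > 0 and m - j < m. For j = 0 both sides
      vanish, since m > 0 and \<open>gen_f ^ 0\<close> is the constant 1.\<close>
    proof (cases "j = 0 \<or> m < j")
      case True
      with False show ?thesis by (auto simp: partitions_largest_empty)
    next
      case False
      then show ?thesis using less.IH[of "m - j" j] by auto
    qed
    then show ?thesis
      using False less.prems by (simp add: gen_f_power_nth_rec[of r m] sum_weight_rec)
  qed
qed

theorem theorem1:
  fixes n k :: nat
  shows "qbinomial n k = (\<Sum>xs\<in>partitions_largest (n + 1) (k + 1). weight xs)"
proof (cases "k \<le> n")
  case True
  then have "k + 1 + (n - k) = n + 1" by simp
  with True gen_f_power_nth[of "k + 1" "n - k"] show ?thesis
    by (simp only: qbinomial_def) simp
next
  case False
  then show ?thesis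
    by (simp add: qbinomial_def partitions_largest_empty)
qed

end
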